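(* Let $n\ge 1$ and let $B^n=\{x\in\mathbb{R}^n : d_{\mathrm{tr}}(0,x)\le 1\}$ be the tropical unit ball; equivalently, $B^n=\{(x_1,\dots,x_n): |x_i|\le 1 \text{ for all } i,\ \max_i x_i-\min_j x_j\le 1\}$. For $c\in\mathbb{R}^n$ put $B^n(c)=c+B^n$. Let $$\Lambda=\Big\{c=(c_1,\dots,c_n)\in\mathbb{Z}^n : \sum_{i=1}^n c_i\equiv 0 \pmod{n+1}\Big\}.$$ Then the collection $\{B^n(c): c\in\Lambda\}$ forms a honeycomb of $\mathbb{R}^n$: its union is $\mathbb{R}^n$, distinct members have disjoint interiors, and the tiling is facet-to-facet.
   Context: The tropical distance on $\mathbb{R}^n$ is $d_{\mathrm{tr}}(x,y)=\max\{\max_{1\le i\le n}(x_i-y_i),0\}-\min\{\min_{1\le i\le n}(x_i-y_i),0\}$ (this is the additive Hilbert projective metric on $\mathbb{R}^{n+1}/\mathbb{R}(1,\dots,1)$ under the identification $(x_1:\dots:x_{n+1})\mapsto (x_1-x_{n+1},\dots,x_n-x_{n+1})$). A tiling is facet-to-facet if any two tiles meeting in an $(n-1)$-dimensional set meet in a common facet of both. *)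

theory Defs
  imports "HOL-Analysis.Analysis" "HOL-Number_Theory.Cong"
begin

definition trop_dist :: "real^'n \<Rightarrow> real^'n \<Rightarrow> real" where
  "trop_dist x y = max (MAX i. x $ i - y $ i) 0 - min (MIN i. x $ i - y $ i) 0"

definition trop_unit_ball :: "(real^'n) set" where
  "trop_unit_ball = {x. trop_dist 0 x \<le> 1}"

definition trop_ball :: "real^'n \<Rightarrow> (real^'n) set" where
  "trop_ball c = (\<lambda>x. c + x) ` trop_unit_ball"

definition trop_lattice :: "(real^'n) set" where
  "trop_lattice =
    {c. \<exists>z :: int^'n. (\<forall>i. c $ i = of_int (z $ i)) \<and>
                    [(\<Sum>i\<in>UNIV. z $ i) = 0] (mod (int CARD('n) + 1))}"

(* The tiles in question are convex, so aff_dim of an intersection is its dimension. *)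
definition facet_to_facet :: "'a::euclidean_space set set \<Rightarrow> bool" where
  "facet_to_facet \<T> \<longleftrightarrow>
    (\<forall>S\<in>\<T>. \<forall>T\<in>\<T>. S \<noteq> T \<and> aff_dim (S \<inter> T) = int DIM('a) - 1 \<longrightarrow>
       (S \<inter> T) facet_of S \<and> (S \<inter> T) facet_of T)"

definition honeycomb :: "'a::euclidean_space set set \<Rightarrow> bool" where
  "honeycomb \<T> \<longleftrightarrow>
    \<Union>\<T> = UNIV \<and>
    pairwise (\<lambda>S T. interior S \<inter> interior T = {}) \<T> \<and>
    facet_to_facet \<T>"

end

(* Add a coordinate x_0 = 0, so that the ball becomes "all coordinates lie in an interval of
   length 1" and the lattice becomes the root lattice A_n: subtracting m from all n + 1 coordinates
   of c, where the sum of c is (n + 1) m, gives an integer vector d of sum 0.  In this picture the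
   ball is the Voronoi cell of A_n.  Indeed, for u in [0,1] and an integer d we have
   d u <= d (d + 1) / 2, with equality only if u - d is again in [0,1].  Summing over the n + 1
   coordinates shows that the bisector of 0 and c supports the ball and that the ball meets it
   exactly in the intersection with the tile of c.  Thus any two tiles meet in a common face, lying
   in a hyperplane.  To cover a point x, round all coordinates down, except the k ones with the
   largest fractional parts, which are rounded up; k is determined by the congruence. *)

theory Submission
  imports Defs
begin

section \<open>The unit ball as a sliding unit interval\<close>

lemma MIN_component_attained:
  fixes x :: "real^'n"
  obtains j where "(MIN i. x $ i) = x $ j"
proof -
  have "(MIN i. x $ i) \<in> range (($) x)"
    by (intro Min_in) auto
  then show thesis
    using that by blast
qed

text \<open>With x_0 = 0 adjoined, the distance to 0 is the spread of n + 1 coordinates. A spread of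
  at most 1 means that they share an interval [t, t + 1]; the range of \<open>t\<close> says that
  x_0 lies in it too.\<close>

lemma trop_unit_ball_iff:
  fixes x :: "real^'n"
  shows "x \<in> trop_unit_ball \<longleftrightarrow> (\<exists>t\<in>{-1..0}. \<forall>i. x $ i \<in> {t..t + 1})"
proof
  \<comment> \<open>The least of the n + 1 coordinates, x_0 = 0 included.\<close>
  define t where "t = min 0 (MIN i. x $ i)"
  assume "x \<in> trop_unit_ball"
  then have d: "max (MAX i. - x $ i) 0 - min (MIN i. - x $ i) 0 \<le> 1"
    by (simp add: trop_unit_ball_def trop_dist_def)
  have lo: "- x $ i \<le> (MAX i. - x $ i)" "(MIN i. - x $ i) \<le> - x $ i" for i
    by auto
  obtain j where j: "(MIN i. x $ i) = x $ j"
    by (rule MIN_component_attained)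
  have "x $ j \<le> x $ i" for i
    unfolding j[symmetric] by simp
  then have "t \<in> {-1..0}" "x $ i \<in> {t..t + 1}" for i
    using lo(1)[of j] lo[of i] lo(2)[of j] d unfolding t_def j atLeastAtMost_iff
    by (smt (verit, best))+
  then show "\<exists>t\<in>{-1..0}. \<forall>i. x $ i \<in> {t..t + 1}"
    by blast
next
  assume "\<exists>t\<in>{-1..0}. \<forall>i. x $ i \<in> {t..t + 1}"
  then obtain t where t: "t \<in> {-1..0}" and x: "\<And>i. t \<le> x $ i \<and> x $ i \<le> t + 1"
    by auto
  have "(MAX i. - x $ i) \<le> - t"
    using x by auto
  moreover have "- t - 1 \<le> (MIN i. - x $ i)"
    using x by (intro Min.boundedI) (auto simp: algebra_simps)
  ultimately have "max (MAX i. - x $ i) 0 - min (MIN i. - x $ i) 0 \<le> 1"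
    using t unfolding atLeastAtMost_iff by linarith
  then show "x \<in> trop_unit_ball"
    by (simp add: trop_unit_ball_def trop_dist_def)
qed

lemma trop_unit_ball_eq:
  "(trop_unit_ball :: (real^'n) set) =
     {x. (\<forall>i. \<bar>x $ i\<bar> \<le> 1) \<and> (MAX i. x $ i) - (MIN j. x $ j) \<le> 1}"
proof (intro set_eqI iffI)
  fix x :: "real^'n"
  assume "x \<in> trop_unit_ball"
  then obtain t where t: "t \<in> {-1..0}" and x: "\<And>i. t \<le> x $ i \<and> x $ i \<le> t + 1"
    by (auto simp: trop_unit_ball_iff)
  have "(MAX i. x $ i) \<le> t + 1" "(MIN i. x $ i) \<ge> t"
    using x by auto
  moreover have "\<bar>x $ i\<bar> \<le> 1" for i
    using t x[of i] by auto
  ultimately show "x \<in> {x. (\<forall>i. \<bar>x $ i\<bar> \<le> 1) \<and> (MAX i. x $ i) - (MIN j. x $ j) \<le> 1}"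
    by (simp del: Max_le_iff Min_ge_iff)
next
  fix x :: "real^'n"
  define t where "t = min 0 (MIN i. x $ i)"
  assume "x \<in> {x. (\<forall>i. \<bar>x $ i\<bar> \<le> 1) \<and> (MAX i. x $ i) - (MIN j. x $ j) \<le> 1}"
  then have x1: "\<forall>i. \<bar>x $ i\<bar> \<le> 1" and x2: "(MAX i. x $ i) - (MIN j. x $ j) \<le> 1"
    by auto
  obtain j where j: "(MIN i. x $ i) = x $ j"
    by (rule MIN_component_attained)
  have "-1 \<le> (MIN i. x $ i)"
    using x1[rule_format, of j] unfolding j by linarith
  then have "t \<in> {-1..0}"
    by (simp add: t_def del: Min_ge_iff)
  moreover have "x $ i \<in> {t..t + 1}" for i
  proof -
    have "(MIN i. x $ i) \<le> x $ i" "x $ i \<le> (MAX i. x $ i)"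
      by auto
    then show ?thesis
      using x1[rule_format, of i] x2 unfolding t_def atLeastAtMost_iff by linarith
  qed
  ultimately show "x \<in> trop_unit_ball"
    unfolding trop_unit_ball_iff by blast
qed

lemma uminus_trop_unit_ball:
  assumes "x \<in> trop_unit_ball"
  shows "- x \<in> trop_unit_ball"
proof -
  from assms obtain t where "t \<in> {-1..0}" and "\<And>i. t \<le> x $ i \<and> x $ i \<le> t + 1"
    by (auto simp: trop_unit_ball_iff)
  then show ?thesis
    \<comment> \<open>Reflection sends [t, t + 1] to [-t - 1, -t].\<close>
    unfolding trop_unit_ball_iff by (intro bexI[of _ "- t - 1"]) (auto simp: algebra_simps)
qed

lemma convex_trop_unit_ball: "convex (trop_unit_ball :: (real^'n) set)"
proof (rule convexI)
  fix x y :: "real^'n" and u v :: real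
  assume uv: "0 \<le> u" "0 \<le> v" "u + v = 1"
  assume "x \<in> trop_unit_ball" "y \<in> trop_unit_ball"
  then obtain s t
    where s: "s \<in> {-1..0}" "\<And>i. x $ i \<in> {s..s + 1}"
      and t: "t \<in> {-1..0}" "\<And>i. y $ i \<in> {t..t + 1}"
    unfolding trop_unit_ball_iff by blast
  have "u *\<^sub>R s + v *\<^sub>R t \<in> {-1..0}"
    using s t uv by (intro convexD[OF convex_real_interval(5)])
  moreover have "u * s + v * t \<le> u * x $ i + v * y $ i" for i
    using s(2)[of i] t(2)[of i] uv by (intro add_mono mult_left_mono) auto
  moreover have "u * x $ i + v * y $ i \<le> u * (s + 1) + v * (t + 1)" for i
    using s(2)[of i] t(2)[of i] uv by (intro add_mono mult_left_mono) auto
  moreover have "u * (s + 1) + v * (t + 1) = u * s + v * t + 1"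
    using uv by (simp add: algebra_simps)
  ultimately show "u *\<^sub>R x + v *\<^sub>R y \<in> trop_unit_ball"
    unfolding trop_unit_ball_iff by (intro bexI[of _ "u * s + v * t"]) auto
qed

lemma interior_trop_unit_ball_nonempty: "interior (trop_unit_ball :: (real^'n) set) \<noteq> {}"
proof -
  have "ball 0 (1/2) \<subseteq> (trop_unit_ball :: (real^'n) set)"
  proof
    fix x :: "real^'n"
    assume "x \<in> ball 0 (1/2)"
    then have "- 1/2 \<le> x $ i \<and> x $ i \<le> 1/2" for i
      using component_le_norm_cart[of x i] by (simp add: abs_le_iff)
    then show "x \<in> trop_unit_ball"
      unfolding trop_unit_ball_iff
      by (intro bexI[of _ "-1/2"]) auto
  qed
  then have "0 \<in> interior (trop_unit_ball :: (real^'n) set)"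
    by (intro interiorI[of "ball 0 (1/2)"]) auto
  then show ?thesis
    by blast
qed

section \<open>Tiles and the lattice of their centres\<close>

lemma trop_ball_iff: "x \<in> trop_ball c \<longleftrightarrow> x - c \<in> trop_unit_ball"
  by (force simp: trop_ball_def image_iff)

lemma convex_trop_ball: "convex (trop_ball c)"
  unfolding trop_ball_def by (rule convex_translation[OF convex_trop_unit_ball])

lemma aff_dim_trop_ball: "aff_dim (trop_ball c :: (real^'n) set) = int CARD('n)"
  unfolding trop_ball_def aff_dim_translation_eq
  using aff_dim_nonempty_interior[OF interior_trop_unit_ball_nonempty] by simp

lemma trop_latticeE:
  fixes c :: "real^'n"
  assumes "c \<in> trop_lattice"
  obtains z :: "'n \<Rightarrow> int" and m
    where "\<And>i. c $ i = of_int (z i)" "sum z UNIV = (int CARD('n) + 1) * m"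
  using assms by (auto simp: trop_lattice_def cong_0_iff elim!: dvdE)

lemma trop_latticeI:
  fixes c :: "real^'n"
  assumes "\<And>i. c $ i = of_int (z i)" "(int CARD('n) + 1) dvd sum z UNIV"
  shows "c \<in> trop_lattice"
  using assms by (auto simp: trop_lattice_def cong_0_iff intro!: exI[of _ "\<chi> i. z i"])

lemma diff_trop_lattice:
  fixes c d :: "real^'n"
  assumes "c \<in> trop_lattice" "d \<in> trop_lattice"
  shows "c - d \<in> trop_lattice"
proof -
  obtain y k where "\<And>i. c $ i = of_int (y i)" "sum y UNIV = (int CARD('n) + 1) * k"
    by (rule trop_latticeE[OF assms(1)]) blast
  moreover obtain z m where "\<And>i. d $ i = of_int (z i)" "sum z UNIV = (int CARD('n) + 1) * m"
    by (rule trop_latticeE[OF assms(2)]) blast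
  ultimately show ?thesis
    by (intro trop_latticeI[where z = "\<lambda>i. y i - z i"]) (auto simp: sum_subtractf)
qed

section \<open>Bisectors between lattice points\<close>

text \<open>The gap d (d + 1) / 2 - d u is half of (u - d - 1/2)^2 - (u - 1/2)^2, and the points of
  [0, 1] are exactly those nearest to 1/2 in their class modulo 1.\<close>

lemma int_mult_unit_interval:
  fixes d :: int and u :: real
  assumes "u \<in> {0..1}"
  shows "d * u \<le> d * (d + 1) / 2"
    and "d * u = d * (d + 1) / 2 \<Longrightarrow> u - d \<in> {0..1}"
proof -
  consider "d \<ge> 2" | "d = 1" | "d = 0" | "d = -1" | "d \<le> -2"
    by linarith
  then have "d * u \<le> d * (d + 1) / 2 \<and> (d * u = d * (d + 1) / 2 \<longrightarrow> u - d \<in> {0..1})"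
  proof cases
    case 1
    then have "real_of_int d * u \<le> real_of_int d * 1"
      using assms by (intro mult_left_mono) auto
    moreover have "real_of_int d * 2 < real_of_int d * (real_of_int d + 1)"
      using 1 by (intro mult_strict_left_mono) auto
    ultimately show ?thesis
      unfolding of_int_mult of_int_add of_int_1 by linarith
  next
    case 5
    then have "d * u \<le> 0" "real_of_int d * (d + 1) > 0"
      using assms by (auto simp: mult_le_0_iff zero_less_mult_iff)
    then show ?thesis
      unfolding of_int_mult of_int_add of_int_1 by linarith
  qed (use assms in auto)
  then show "d * u \<le> d * (d + 1) / 2" "d * u = d * (d + 1) / 2 \<Longrightarrow> u - d \<in> {0..1}"
    by auto
qed

text \<open>The first \<open>n\<close> coordinates of the projection of \<open>(c, 0)\<close> to the hyperplane of sum 0; so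
  \<open>bisector_normal c \<bullet> x\<close> is the inner product of the projections of \<open>(c, 0)\<close> and \<open>(x, 0)\<close>.\<close>

definition bisector_normal :: "real^'n \<Rightarrow> real^'n" where
  "bisector_normal c = (\<chi> i. c $ i - (\<Sum>j\<in>UNIV. c $ j) / (CARD('n) + 1))"

text \<open>A zero projection makes (c, 0) constant, hence zero: the common value S / (n + 1) summed
  over n coordinates must give S back, so S = 0.\<close>

lemma bisector_normal_nonzero:
  fixes c :: "real^'n"
  assumes "c \<noteq> 0"
  shows "bisector_normal c \<noteq> 0"
proof
  define S where "S = (\<Sum>j\<in>UNIV. c $ j)"
  have "bisector_normal c $ i = c $ i - S / (CARD('n) + 1)" for i
    by (simp add: bisector_normal_def S_def)
  moreover assume "bisector_normal c = 0"
  ultimately have c: "c $ i = S / (CARD('n) + 1)" for i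
    by simp
  have "S = (\<Sum>i::'n\<in>UNIV. S / (CARD('n) + 1))"
    unfolding S_def by (intro sum.cong refl c[unfolded S_def])
  then have "S = 0"
    by (simp add: field_simps)
  with c assms show False
    by (simp add: vec_eq_iff)
qed

lemma bisector_trop_unit_ball:
  fixes c :: "real^'n"
  assumes c: "c \<in> trop_lattice" and y: "y \<in> trop_unit_ball"
  shows "bisector_normal c \<bullet> y \<le> bisector_normal c \<bullet> c / 2"
    and "bisector_normal c \<bullet> y = bisector_normal c \<bullet> c / 2 \<Longrightarrow> y - c \<in> trop_unit_ball"
proof -
  obtain z m where z: "\<And>i. c $ i = of_int (z i)"
    and m: "sum z UNIV = (int CARD('n) + 1) * m"
    by (rule trop_latticeE[OF c]) blast
  obtain t where "t \<in> {-1..0}" "\<And>i. y $ i \<in> {t..t + 1}"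
    using y unfolding trop_unit_ball_iff by blast
  then have t: "- t \<in> {0..1}" and yt: "\<And>i. y $ i - t \<in> {0..1}"
    by (auto simp: algebra_simps)
  \<comment> \<open>Together with -m in the extra coordinate, these entries have sum 0.\<close>
  define d where "d i = z i - m" for i
  \<comment> \<open>The gap in \<open>int_mult_unit_interval\<close>, to be applied to each of the n
    + 1 coordinates.\<close>
  define g where "g e u = of_int e * (of_int e + 1) / 2 - of_int e * u" for e :: int and u :: real
  have g_nonneg: "g e u \<ge> 0" if "u \<in> {0..1}" for e u
    using int_mult_unit_interval(1)[OF that, of e] by (simp add: g_def)
  have g_zero: "u - e \<in> {0..1}" if "u \<in> {0..1}" "g e u = 0" for e u
    using that(2) by (intro int_mult_unit_interval(2)[OF that(1)]) (auto simp: g_def)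
  have sz: "(\<Sum>i\<in>UNIV. c $ i) = (CARD('n) + 1) * m"
    using arg_cong[OF m, of real_of_int] by (simp add: z)
  have sd: "(\<Sum>i\<in>UNIV. real_of_int (d i)) = m"
    using sz by (simp add: d_def sum_subtractf z algebra_simps)
  have a: "bisector_normal c $ i = d i" for i
    unfolding bisector_normal_def sz by (simp add: d_def z)
  have "bisector_normal c \<bullet> c = (\<Sum>i\<in>UNIV. d i * (d i + m))"
    by (simp add: inner_vec_def a z d_def)
  also have "\<dots> = (\<Sum>i\<in>UNIV. d i * d i) + m * (\<Sum>i\<in>UNIV. d i)"
    by (simp add: algebra_simps sum.distrib sum_distrib_left)
  finally have ac: "bisector_normal c \<bullet> c = (\<Sum>i\<in>UNIV. (d i)\<^sup>2) + m\<^sup>2"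
    using sd by (simp add: power2_eq_square)
  have "(\<Sum>i\<in>UNIV. g (d i) (y $ i - t)) =
      (\<Sum>i\<in>UNIV. (d i)\<^sup>2 / 2 + d i * (1/2 + t) - d i * y $ i)"
    by (intro sum.cong) (auto simp: g_def field_simps power2_eq_square)
  also have "\<dots> = (\<Sum>i\<in>UNIV. (d i)\<^sup>2) / 2 + m * (1/2 + t) - bisector_normal c \<bullet> y"
    by (simp add: sum.distrib sum_subtractf sd a inner_vec_def
        flip: sum_divide_distrib sum_distrib_right)
  \<comment> \<open>The last summand belongs to x_0 = 0, whose position in the interval is 0 - t and
    whose integer is -m. The terms with 1/2 + t cancel because the integers have sum 0.\<close>
  finally have total: "(\<Sum>i\<in>UNIV. g (d i) (y $ i - t)) + g (- m) (- t) =
      bisector_normal c \<bullet> c / 2 - bisector_normal c \<bullet> y"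
    unfolding ac by (simp add: g_def field_simps power2_eq_square)
  have sum_nonneg: "(\<Sum>i\<in>UNIV. g (d i) (y $ i - t)) \<ge> 0"
    by (intro sum_nonneg g_nonneg yt)
  then show "bisector_normal c \<bullet> y \<le> bisector_normal c \<bullet> c / 2"
    using total g_nonneg[OF t, of "- m"] by linarith
  \<comment> \<open>Equality forces each of the n + 1 nonnegative gaps to vanish.\<close>
  assume "bisector_normal c \<bullet> y = bisector_normal c \<bullet> c / 2"
  then have "g (- m) (- t) = 0" and s0: "(\<Sum>i\<in>UNIV. g (d i) (y $ i - t)) = 0"
    using total g_nonneg[OF t, of "- m"] sum_nonneg by linarith+
  then have "- t + m \<in> {0..1}"
    using g_zero[OF t] by force
  moreover have "g (d i) (y $ i - t) = 0" for i
    using s0 by (subst (asm) sum_nonneg_eq_0_iff) (auto intro!: g_nonneg simp: yt[simplified])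
  then have "y $ i - t - d i \<in> {0..1}" for i
    using g_zero[OF yt] by blast
  ultimately show "y - c \<in> trop_unit_ball"
    unfolding trop_unit_ball_iff
    \<comment> \<open>Here y_i - c_i = (y_i - t - d_i) + (t - m), and the gap of x_0 gives the range
      of t - m.\<close>
    by (intro bexI[of _ "t - m"]) (auto simp: z d_def algebra_simps)
qed

text \<open>Translating by -c reduces this to the bisector of 0 and d - c; the two tiles lie on
  opposite sides of it.\<close>

lemma trop_ball_Int:
  assumes "c \<in> trop_lattice" "d \<in> trop_lattice"
  defines "a \<equiv> bisector_normal (d - c)"
  defines "b \<equiv> a \<bullet> c + a \<bullet> (d - c) / 2"
  shows "trop_ball c \<inter> trop_ball d = trop_ball c \<inter> {x. a \<bullet> x = b}"
    and "x \<in> trop_ball c \<Longrightarrow> a \<bullet> x \<le> b"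
proof -
  have dc: "d - c \<in> trop_lattice"
    using assms by (simp add: diff_trop_lattice)
  note bisector = bisector_trop_unit_ball[OF dc, folded a_def]
  show le: "a \<bullet> x \<le> b" if "x \<in> trop_ball c" for x
    using bisector(1)[of "x - c"] that
    by (simp add: trop_ball_iff b_def inner_diff_right field_simps)
  \<comment> \<open>Central symmetry of the ball turns the bound at c into the reverse bound at
    d.\<close>
  have "a \<bullet> x \<ge> b" if "x \<in> trop_ball d" for x
    using bisector(1)[of "- (x - d)"] uminus_trop_unit_ball[of "x - d"] that
    by (simp add: trop_ball_iff b_def inner_diff_right field_simps)
  moreover have "x \<in> trop_ball d" if "x \<in> trop_ball c" "a \<bullet> x = b" for x
    using bisector(2)[of "x - c"] that by (simp add: trop_ball_iff b_def inner_diff_right)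
  ultimately show "trop_ball c \<inter> trop_ball d = trop_ball c \<inter> {x. a \<bullet> x = b}"
    using le by (auto intro: antisym)
qed

lemma trop_ball_Int_face_of:
  assumes "c \<in> trop_lattice" "d \<in> trop_lattice"
  shows "trop_ball c \<inter> trop_ball d face_of trop_ball c"
  unfolding trop_ball_Int(1)[OF assms]
  by (intro face_of_Int_supporting_hyperplane_le convex_trop_ball trop_ball_Int(2)[OF assms])

text \<open>The common part lies in a hyperplane with nonzero normal, which has empty
  interior.\<close>

lemma interior_trop_ball_disjoint:
  assumes "c \<in> trop_lattice" "d \<in> trop_lattice" "c \<noteq> d"
  shows "interior (trop_ball c) \<inter> interior (trop_ball d) = {}"
proof -
  have "bisector_normal (d - c) \<noteq> 0"
    using assms by (simp add: bisector_normal_nonzero)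
  then show ?thesis
    unfolding interior_Int[symmetric] trop_ball_Int(1)[OF assms(1,2)]
    by (simp add: interior_Int)
qed

section \<open>Covering by rounding\<close>

text \<open>Supplies the coordinates to be rounded up. The set is built greedily, adding a maximiser
  of \<open>f\<close> among the remaining elements, so ties do no harm.\<close>

lemma exists_top_subset:
  fixes f :: "'a \<Rightarrow> 'b::linorder"
  assumes "finite A" "k \<le> card A"
  obtains U where "U \<subseteq> A" "card U = k" "\<And>u v. u \<in> U \<Longrightarrow> v \<in> A - U \<Longrightarrow> f v \<le> f u"
  using assms(2)
proof (induction k arbitrary: thesis)
  case 0
  show ?case
    by (rule 0(1)[of "{}"]) auto
next
  case (Suc k)
  obtain U where U: "U \<subseteq> A" "card U = k" "\<And>u v. u \<in> U \<Longrightarrow> v \<in> A - U \<Longrightarrow> f v \<le> f u"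
    using Suc by (metis Suc_leD)
  have "A - U \<noteq> {}"
    using U Suc.prems(2) by auto
  then have "Max (f ` (A - U)) \<in> f ` (A - U)"
    using assms(1) by (intro Max_in) auto
  then obtain w where w: "w \<in> A - U" "f w = Max (f ` (A - U))"
    by auto
  then have "f v \<le> f w" if "v \<in> A - U" for v
    using assms(1) that by simp
  with U w show ?case
    using assms(1) finite_subset[OF U(1) assms(1)]
    by (intro Suc.prems(1)[of "insert w U"]) auto
qed

lemma trop_ball_cover:
  fixes x :: "real^'n"
  shows "\<exists>c\<in>trop_lattice. x \<in> trop_ball c"
proof -
  define s where "s = (\<Sum>i\<in>UNIV. \<lfloor>x $ i\<rfloor>)"
  \<comment> \<open>Rounding up \<open>k\<close> coordinates adds \<open>k\<close> to the sum
    \<open>s\<close>, which makes it divisible by n + 1. As a residue, \<open>k\<close> is at most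
    n, so there are enough coordinates.\<close>
  define k where "k = nat ((- s) mod (int CARD('n) + 1))"
  have k: "int k = (- s) mod (int CARD('n) + 1)"
    by (simp add: k_def)
  have "(- s) mod (int CARD('n) + 1) < int CARD('n) + 1"
    by (intro pos_mod_bound) auto
  then have "k \<le> CARD('n)"
    using k by linarith
  then obtain U :: "'n set" where U: "card U = k"
    "\<And>u v. u \<in> U \<Longrightarrow> v \<notin> U \<Longrightarrow> frac (x $ v) \<le> frac (x $ u)"
    using exists_top_subset[of "UNIV :: 'n set" k "\<lambda>i. frac (x $ i)"] by auto
  define z where "z i = \<lfloor>x $ i\<rfloor> + of_bool (i \<in> U)" for i
  define c :: "real^'n" where "c = (\<chi> i. of_int (z i))"
  have "sum z UNIV = s + int k"
    by (simp add: z_def sum.distrib s_def U(1))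
  moreover have "(int CARD('n) + 1) dvd s + int k"
    unfolding k by (metis add.right_inverse mod_0_imp_dvd mod_add_right_eq mod_0)
  ultimately have c: "c \<in> trop_lattice"
    by (intro trop_latticeI[of c z]) (auto simp: c_def)
  have xc: "(x - c) $ i = frac (x $ i) - of_bool (i \<in> U)" for i
    by (simp add: c_def z_def frac_def)
  have "\<exists>t\<in>{-1..0}. \<forall>i. (x - c) $ i \<in> {t..t + 1}"
  \<comment> \<open>With nothing rounded up there is no minimum over \<open>U\<close> to take, but
    all differences are fractional parts and [0, 1] serves.\<close>
  proof (cases "U = {}")
    case True
    then show ?thesis
      unfolding xc by (intro bexI[of _ 0]) (auto simp: less_imp_le frac_lt_1)
  next
    case False
    \<comment> \<open>Rounded-up coordinates differ from \<open>c\<close> by values in [t - 1, 0];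
      the others, by the choice of \<open>U\<close>, by values in [0, t].\<close>
    define t where "t = Min ((\<lambda>i. frac (x $ i)) ` U)"
    have "t \<in> (\<lambda>i. frac (x $ i)) ` U"
      unfolding t_def using False by (intro Min_in) auto
    then obtain u where u: "u \<in> U" "t = frac (x $ u)"
      by blast
    then have t: "0 \<le> t" "t < 1"
      using frac_ge_0 frac_lt_1 by auto
    have "(x - c) $ i \<in> {t - 1..t - 1 + 1}" for i
    proof (cases "i \<in> U")
      case True
      then have "t \<le> frac (x $ i)"
        by (simp add: t_def)
      then show ?thesis
        unfolding xc using True t frac_lt_1[of "x $ i"] by simp
    next
      case False
      then have "(x - c) $ i = frac (x $ i)"
        unfolding xc by simp
      with False show ?thesis
        using t u U(2)[of u i] frac_ge_0[of "x $ i"]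
        unfolding atLeastAtMost_iff by linarith
    qed
    moreover have "t - 1 \<in> {-1..0}"
      using t by simp
    ultimately show ?thesis
      by blast
  qed
  then have "x \<in> trop_ball c"
    by (simp only: trop_ball_iff trop_unit_ball_iff)
  with c show ?thesis
    by blast
qed

theorem theorem6p1:
  shows "(trop_unit_ball :: (real^'n) set) =
           {x. (\<forall>i. \<bar>x $ i\<bar> \<le> 1) \<and> (MAX i. x $ i) - (MIN j. x $ j) \<le> 1} \<and>
         honeycomb {trop_ball c |c :: real^'n. c \<in> trop_lattice}"
proof (intro conjI trop_unit_ball_eq)
  let ?T = "{trop_ball c |c :: real^'n. c \<in> trop_lattice}"
  have "\<Union>?T = UNIV"
    using trop_ball_cover by blast
  moreover have "pairwise (\<lambda>S T. interior S \<inter> interior T = {}) ?T"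
    unfolding pairwise_def using interior_trop_ball_disjoint by blast
  \<comment> \<open>A face of dimension n - 1 of an n-dimensional tile is a facet, nonempty as n - 1
    > -1. Exchanging c and d gives the other tile.\<close>
  moreover have "trop_ball c \<inter> trop_ball d facet_of trop_ball c"
    if "c \<in> trop_lattice" "d \<in> trop_lattice"
      "aff_dim (trop_ball c \<inter> trop_ball d) = int CARD('n) - 1" for c d :: "real^'n"
    using that trop_ball_Int_face_of[OF that(1,2)]
    by (auto simp: facet_of_def aff_dim_trop_ball)
  then have "facet_to_facet ?T"
    unfolding facet_to_facet_def by (fastforce simp: Int_commute)
  ultimately show "honeycomb ?T"
    by (simp add: honeycomb_def)
qed

end
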